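(* Let $\lambda\in\mathbb{C}^*$, $\alpha,\beta,\gamma\in\mathbb{C}$ and $h(t)\in\mathbb{C}[t]$. Then $\Phi(\lambda,\alpha,\beta,\gamma,h(t))=\mathbb{C}[s,t]$, with the operators $L_m,M_m,S_m,I_m$ $(m\in\mathbb{Z})$ on $\mathbb{C}[s,t]$ specified in the context, is a module over the Lie algebra $\mathfrak{L}$. Moreover, $\Phi(\lambda,\alpha,\beta,\gamma,h(t))$ is irreducible if and only if $\alpha\neq0$ or $\beta\neq0$.
   Context: All vector spaces are over $\mathbb{C}$; $\mathbb{C}^*$ is the set of nonzero complex numbers. The BMS-Kac-Moody algebra $\mathfrak{L}$ is the complex Lie algebra with basis $\{L_m,M_m,S_m,I_m\mid m\in\mathbb{Z}\}$ and nontrivial brackets, for all $m,n\in\mathbb{Z}$, $$[L_m,L_n]=(n-m)L_{m+n},\quad [L_m,M_n]=(n-m)M_{m+n},\quad [L_m,S_n]=nS_{m+n},$$ $$[L_m,I_n]=nI_{m+n},\quad [M_m,I_n]=-nS_{m+n}$$ (all other brackets between basis elements, apart from those determined by skew-symmetry, are zero). For $\lambda\in\mathbb{C}^*$, $\alpha,\beta,\gamma\in\mathbb{C}$ and $h(t)\in\mathbb{C}[t]$, set for $m\in\mathbb{Z}$ $$h_m(t)=m h(t)-m(m-1)\alpha\frac{h(t)-h(\alpha)}{t-\alpha}\in\mathbb{C}[t].$$ Let $\Phi(\lambda,\alpha,\beta,\gamma,h(t))$ denote the vector space $\mathbb{C}[s,t]$ with the operators defined, for $f(s,t)\in\mathbb{C}[s,t]$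 and $m\in\mathbb{Z}$, by $$L_m\cdot f(s,t)=\lambda^m(s+h_m(t))f(s-m,t)-m\lambda^m(t-m\alpha)\frac{\partial}{\partial t}\big(f(s-m,t)\big),$$ $$M_m\cdot f(s,t)=\lambda^m(t-m\alpha)f(s-m,t),\qquad S_m\cdot f(s,t)=\lambda^m\beta f(s-m,t),$$ $$I_m\cdot f(s,t)=\lambda^m\Big(\gamma-m\beta\frac{h(t)-h(\alpha)}{t-\alpha}\Big)f(s-m,t)+m\lambda^m\beta\frac{\partial}{\partial t}\big(f(s-m,t)\big).$$ *)

theory Defs
  imports "HOL-Library.Poly_Mapping" "HOL-Computational_Algebra.Polynomial" "HOL.Vector_Spaces" Complex_Main
begin

section \<open>Lie algebras and their modules\<close>

locale lie_algebra = vector_space scale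
  for scale :: "'k::field \<Rightarrow> 'g::ab_group_add \<Rightarrow> 'g" +
  fixes bracket :: "'g \<Rightarrow> 'g \<Rightarrow> 'g"
  assumes linear_left: "Vector_Spaces.linear scale scale (\<lambda>x. bracket x y)"
    and linear_right: "Vector_Spaces.linear scale scale (bracket x)"
    and alternating: "bracket x x = 0"
    and jacobi: "bracket x (bracket y z) + bracket y (bracket z x) + bracket z (bracket x y) = 0"

locale lie_module = lie_algebra scale bracket + V: vector_space scaleV
  for scale :: "'k::field \<Rightarrow> 'g::ab_group_add \<Rightarrow> 'g"
    and bracket :: "'g \<Rightarrow> 'g \<Rightarrow> 'g"
    and scaleV :: "'k \<Rightarrow> 'v::ab_group_add \<Rightarrow> 'v" +
  fixes act :: "'g \<Rightarrow> 'v \<Rightarrow> 'v"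
  assumes act_linear_left: "Vector_Spaces.linear scale scaleV (\<lambda>x. act x v)"
    and act_linear_right: "Vector_Spaces.linear scaleV scaleV (act x)"
    and act_bracket: "act (bracket x y) v = act x (act y v) - act y (act x v)"

definition lie_submodule ::
  "('k::comm_ring_1 \<Rightarrow> 'v::ab_group_add \<Rightarrow> 'v) \<Rightarrow> ('g \<Rightarrow> 'v \<Rightarrow> 'v) \<Rightarrow> 'v set \<Rightarrow> bool" where
  "lie_submodule scaleV act W \<longleftrightarrow>
     module.subspace scaleV W \<and> (\<forall>x. \<forall>w\<in>W. act x w \<in> W)"

definition irreducible_lie_module ::
  "('k::comm_ring_1 \<Rightarrow> 'v::ab_group_add \<Rightarrow> 'v) \<Rightarrow> ('g \<Rightarrow> 'v \<Rightarrow> 'v) \<Rightarrow> bool" where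
  "irreducible_lie_module scaleV act \<longleftrightarrow>
     (\<exists>v::'v. v \<noteq> 0) \<and> (\<forall>W. lie_submodule scaleV act W \<longrightarrow> W = {0} \<or> W = UNIV)"


section \<open>The BMS-Kac-Moody algebra\<close>

datatype bms_gen = L int | M int | S int | I int

text \<open>Finitely supported coefficient functions: the complex vector space with basis
  \<open>bms_gen\<close>, the basis vectors being \<open>Poly_Mapping.single a 1\<close>.\<close>

type_synonym bms = "bms_gen \<Rightarrow>\<^sub>0 complex"

definition bms_scale :: "complex \<Rightarrow> bms \<Rightarrow> bms" where
  "bms_scale c = Poly_Mapping.map ((*) c)"

definition linear_ext ::
  "(complex \<Rightarrow> 'v \<Rightarrow> 'v) \<Rightarrow> (bms_gen \<Rightarrow> 'v::ab_group_add) \<Rightarrow> bms \<Rightarrow> 'v" where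
  "linear_ext scaleV \<phi> x = (\<Sum>a\<in>Poly_Mapping.keys x. scaleV (Poly_Mapping.lookup x a) (\<phi> a))"

fun bms_bracket_gen :: "bms_gen \<Rightarrow> bms_gen \<Rightarrow> bms" where
  "bms_bracket_gen (L m) (L n) = Poly_Mapping.single (L (m + n)) (of_int (n - m))"
| "bms_bracket_gen (L m) (M n) = Poly_Mapping.single (M (m + n)) (of_int (n - m))"
| "bms_bracket_gen (L m) (S n) = Poly_Mapping.single (S (m + n)) (of_int n)"
| "bms_bracket_gen (L m) (I n) = Poly_Mapping.single (I (m + n)) (of_int n)"
| "bms_bracket_gen (M m) (I n) = Poly_Mapping.single (S (m + n)) (- of_int n)"
| "bms_bracket_gen (M m) (L n) = - Poly_Mapping.single (M (n + m)) (of_int (m - n))"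
| "bms_bracket_gen (S m) (L n) = - Poly_Mapping.single (S (n + m)) (of_int m)"
| "bms_bracket_gen (I m) (L n) = - Poly_Mapping.single (I (n + m)) (of_int m)"
| "bms_bracket_gen (I m) (M n) = - Poly_Mapping.single (S (n + m)) (- of_int m)"
| "bms_bracket_gen _ _ = 0"

definition bms_bracket :: "bms \<Rightarrow> bms \<Rightarrow> bms" where
  "bms_bracket x y =
     linear_ext bms_scale (\<lambda>a. linear_ext bms_scale (bms_bracket_gen a) y) x"

lemma lookup_bms_scale [simp]:
  "Poly_Mapping.lookup (bms_scale c x) a = c * Poly_Mapping.lookup x a"
  by (simp add: bms_scale_def Poly_Mapping.map.rep_eq when_def)

lemma vector_space_bms: "vector_space bms_scale"
  by unfold_locales (auto intro!: poly_mapping_eqI simp: lookup_add algebra_simps)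

lemma linear_ext_superset:
  assumes "vector_space scaleV" "finite A" "Poly_Mapping.keys x \<subseteq> A"
  shows "linear_ext scaleV \<phi> x = (\<Sum>a\<in>A. scaleV (Poly_Mapping.lookup x a) (\<phi> a))"
proof -
  interpret vector_space scaleV by fact
  show ?thesis
    unfolding linear_ext_def
    by (rule sum.mono_neutral_left) (use assms in \<open>auto simp: in_keys_iff\<close>)
qed

lemma linear_linear_ext:
  assumes "vector_space scaleV"
  shows "Vector_Spaces.linear bms_scale scaleV (linear_ext scaleV \<phi>)"
proof -
  interpret V: vector_space scaleV by fact
  interpret B: vector_space bms_scale by (rule vector_space_bms)
  show ?thesis
  proof unfold_locales
    fix x y :: bms
    let ?A = "Poly_Mapping.keys x \<union> Poly_Mapping.keys y"
    have "Poly_Mapping.keys (x + y) \<subseteq> ?A" by (rule Poly_Mapping.keys_add)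
    then show "linear_ext scaleV \<phi> (x + y) = linear_ext scaleV \<phi> x + linear_ext scaleV \<phi> y"
      by (simp add: linear_ext_superset[OF assms, of ?A] lookup_add V.scale_left_distrib sum.distrib)
  next
    fix c and x :: bms
    have "Poly_Mapping.keys (bms_scale c x) \<subseteq> Poly_Mapping.keys x"
      by (auto simp: in_keys_iff)
    then show "linear_ext scaleV \<phi> (bms_scale c x) = scaleV c (linear_ext scaleV \<phi> x)"
      by (simp add: linear_ext_superset[OF assms, of "Poly_Mapping.keys x"] V.scale_sum_right)
  qed
qed

lemma linear_ext_single:
  assumes "vector_space scaleV"
  shows "linear_ext scaleV \<phi> (Poly_Mapping.single a c) = scaleV c (\<phi> a)"
  using linear_ext_superset[OF assms, of "{a}" "Poly_Mapping.single a c" \<phi>] by simp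

lemma bms_bracket_single [simp]:
  "bms_bracket (Poly_Mapping.single a 1) (Poly_Mapping.single b 1) = bms_bracket_gen a b"
  by (simp add: bms_bracket_def linear_ext_single vector_space_bms
        vector_space.vector_space_assms)

lemma linear_bms_bracket_left: "Vector_Spaces.linear bms_scale bms_scale (\<lambda>x. bms_bracket x y)"
  unfolding bms_bracket_def by (rule linear_linear_ext[OF vector_space_bms])

lemma linear_bms_bracket_right: "Vector_Spaces.linear bms_scale bms_scale (bms_bracket x)"
proof -
  interpret B: vector_space bms_scale by (rule vector_space_bms)
  interpret P: vector_space_pair bms_scale bms_scale ..
  have "bms_bracket x = (\<lambda>y. \<Sum>a\<in>Poly_Mapping.keys x.
      bms_scale (Poly_Mapping.lookup x a) (linear_ext bms_scale (bms_bracket_gen a) y))"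
    unfolding bms_bracket_def by (subst linear_ext_def) simp
  then show ?thesis
    by (simp only:) (intro P.linear_compose_sum ballI P.linear_compose_scale_right
          linear_linear_ext[OF vector_space_bms])
qed

lemma bms_induct [case_names zero add scale gen]:
  assumes "P 0" "\<And>x y. P x \<Longrightarrow> P y \<Longrightarrow> P (x + y)" "\<And>c x. P x \<Longrightarrow> P (bms_scale c x)"
    and "\<And>a. P (Poly_Mapping.single a 1)"
  shows "P (x :: bms)"
proof (induction x rule: update_induct)
  case const then show ?case by (rule assms)
next
  case (update f a b)
  have "Poly_Mapping.update a b f = f + bms_scale b (Poly_Mapping.single a 1)"
    using update(1) by (intro poly_mapping_eqI)
      (auto simp: lookup_update lookup_add lookup_single in_keys_iff when_def)
  then show ?case using update assms by simp
qed

lemma lie_algebra_bms: "lie_algebra bms_scale bms_bracket"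
proof -
  interpret B: vector_space bms_scale by (rule vector_space_bms)
  note lin = linear_bms_bracket_left linear_bms_bracket_right
  have addl: "bms_bracket (x + x') y = bms_bracket x y + bms_bracket x' y" for x x' y
    using Vector_Spaces.linear.axioms(3)[OF lin(1), of y, THEN module_hom.add] by simp
  have addr: "bms_bracket y (x + x') = bms_bracket y x + bms_bracket y x'" for x x' y
    using Vector_Spaces.linear.axioms(3)[OF lin(2), of y, THEN module_hom.add] by simp
  have scl: "bms_bracket (bms_scale c x) y = bms_scale c (bms_bracket x y)" for c x y
    using Vector_Spaces.linear.axioms(3)[OF lin(1), of y, THEN module_hom.scale] by simp
  have scr: "bms_bracket y (bms_scale c x) = bms_scale c (bms_bracket y x)" for c x y
    using Vector_Spaces.linear.axioms(3)[OF lin(2), of y, THEN module_hom.scale] by simp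
  have zl: "bms_bracket 0 y = 0" for y using addl[of 0 0 y] by simp
  have zr: "bms_bracket y 0 = 0" for y using addr[of y 0 0] by simp
  have ml: "bms_bracket (- x) y = - bms_bracket x y" for x y
    using addl[of x "-x" y] zl by (simp add: eq_neg_iff_add_eq_0 add.commute)
  have mr: "bms_bracket y (- x) = - bms_bracket y x" for x y
    using addr[of y x "-x"] zr by (simp add: eq_neg_iff_add_eq_0 add.commute)
  have single: "bms_bracket (Poly_Mapping.single a c) (Poly_Mapping.single b d)
      = bms_scale (c * d) (bms_bracket_gen a b)" for a b c d
  proof -
    have e: "Poly_Mapping.single a c = bms_scale c (Poly_Mapping.single a 1)" for a c
      by (intro poly_mapping_eqI) (simp add: lookup_single when_def)
    show ?thesis unfolding e[of a c] e[of b d] scl scr by simp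
  qed
  have skew: "bms_bracket x y + bms_bracket y x = 0" for x y
  proof (induction x rule: bms_induct)
    case (add x x') then show ?case by (simp add: addl addr algebra_simps add_eq_0_iff2)
  next
    case (scale c x) then show ?case
      by (metis scl scr B.scale_right_distrib B.scale_zero_right)
  next
    case (gen a) show ?case
    proof (induction y rule: bms_induct)
      case (add x x') then show ?case by (simp add: addl addr algebra_simps add_eq_0_iff2)
    next
      case (scale c x) then show ?case
        by (metis scl scr B.scale_right_distrib B.scale_zero_right)
    next
      case (gen b) show ?case
        by (cases a; cases b)
          (auto intro!: poly_mapping_eqI simp: lookup_add lookup_single when_def algebra_simps)
    qed (simp add: zl zr)
  qed (simp add: zl zr)
  define J where "J x y z = bms_bracket x (bms_bracket y z) + bms_bracket y (bms_bracket z x)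
      + bms_bracket z (bms_bracket x y)" for x y z
  have Jrot: "J x y z = J y z x" for x y z by (simp add: J_def)
  have Jadd: "J (x + x') y z = J x y z + J x' y z" for x x' y z
    by (simp add: J_def addl addr algebra_simps)
  have Jsc: "J (bms_scale c x) y z = bms_scale c (J x y z)" for c x y z
    by (simp add: J_def scl scr B.scale_right_distrib)
  have J0: "J 0 y z = 0" for y z by (simp add: J_def zl zr)
  have Jgen: "J (Poly_Mapping.single a 1) (Poly_Mapping.single b 1) (Poly_Mapping.single c 1) = 0"
    for a b c
    unfolding J_def
    by (cases a; cases b; cases c)
      (auto intro!: poly_mapping_eqI simp: single ml mr zl zr lookup_add lookup_single when_def
        algebra_simps)
  have J2: "J x (Poly_Mapping.single b 1) (Poly_Mapping.single c 1) = 0" for x b c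
    by (induction x rule: bms_induct) (simp_all add: J0 Jadd Jsc Jgen)
  have J1: "J (Poly_Mapping.single c 1) x y = 0" for x y c
    unfolding Jrot[of _ x y]
    by (induction x rule: bms_induct)
      (simp_all add: J0 Jadd Jsc, simp add: Jrot[of _ y] Jrot[of y] J2)
  have J: "J x y z = 0" for x y z
    by (induction x rule: bms_induct) (simp_all add: J0 Jadd Jsc J1)
  have alt: "bms_bracket x x = 0" for x
  proof (rule poly_mapping_eqI)
    fix a
    have "Poly_Mapping.lookup (bms_bracket x x + bms_bracket x x) a = 0" by (simp add: skew)
    then show "Poly_Mapping.lookup (bms_bracket x x) a = Poly_Mapping.lookup 0 a"
      by (simp add: lookup_add)
  qed
  show ?thesis
    by (intro lie_algebra.intro lie_algebra_axioms.intro vector_space_bms lin alt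
          J[unfolded J_def])
qed


section \<open>The modules \<open>\<Phi>(\<lambda>, \<alpha>, \<beta>, \<gamma>, h(t))\<close>\<close>

text \<open>\<open>\<complex>[s, t]\<close> is \<open>complex poly poly\<close>: polynomials in the outer variable \<open>s\<close> with coefficients
  in \<open>\<complex>[t]\<close>.\<close>

abbreviation scale_st :: "complex \<Rightarrow> complex poly poly \<Rightarrow> complex poly poly" where
  "scale_st c \<equiv> smult [:c:]"

abbreviation s_var :: "complex poly poly" where "s_var \<equiv> [:0, 1:]"

abbreviation in_t :: "complex poly \<Rightarrow> complex poly poly" where "in_t p \<equiv> [:p:]"

definition shift_s :: "int \<Rightarrow> complex poly poly \<Rightarrow> complex poly poly" where
  "shift_s m f = pcompose f (s_var - of_int m)"

definition deriv_t :: "complex poly poly \<Rightarrow> complex poly poly" where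
  "deriv_t f = map_poly pderiv f"

text \<open>\<open>(h(t) - h(\<alpha>)) / (t - \<alpha>)\<close>; the division is exact.\<close>

definition diff_quot :: "complex \<Rightarrow> complex poly \<Rightarrow> complex poly" where
  "diff_quot \<alpha> h = (h - [:poly h \<alpha>:]) div [:- \<alpha>, 1:]"

lemma diff_quot_mult: "[:- \<alpha>, 1:] * diff_quot \<alpha> h = h - [:poly h \<alpha>:]"
  unfolding diff_quot_def by (rule dvd_mult_div_cancel) (simp add: poly_eq_0_iff_dvd[symmetric])

definition h_poly :: "complex \<Rightarrow> complex poly \<Rightarrow> int \<Rightarrow> complex poly" where
  "h_poly \<alpha> h m = smult (of_int m) h - smult (of_int (m * (m - 1)) * \<alpha>) (diff_quot \<alpha> h)"

fun Phi_gen :: "complex \<Rightarrow> complex \<Rightarrow> complex \<Rightarrow> complex \<Rightarrow> complex poly \<Rightarrow>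
    bms_gen \<Rightarrow> complex poly poly \<Rightarrow> complex poly poly" where
  "Phi_gen lam \<alpha> \<beta> \<gamma> h (L m) f =
     scale_st (lam powi m) ((s_var + in_t (h_poly \<alpha> h m)) * shift_s m f)
     - scale_st (of_int m * lam powi m) (in_t [:- of_int m * \<alpha>, 1:] * deriv_t (shift_s m f))"
| "Phi_gen lam \<alpha> \<beta> \<gamma> h (M m) f =
     scale_st (lam powi m) (in_t [:- of_int m * \<alpha>, 1:] * shift_s m f)"
| "Phi_gen lam \<alpha> \<beta> \<gamma> h (S m) f = scale_st (lam powi m * \<beta>) (shift_s m f)"
| "Phi_gen lam \<alpha> \<beta> \<gamma> h (I m) f =
     scale_st (lam powi m) (in_t ([:\<gamma>:] - smult (of_int m * \<beta>) (diff_quot \<alpha> h)) * shift_s m f)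
     + scale_st (of_int m * lam powi m * \<beta>) (deriv_t (shift_s m f))"

definition Phi_act :: "complex \<Rightarrow> complex \<Rightarrow> complex \<Rightarrow> complex \<Rightarrow> complex poly \<Rightarrow>
    bms \<Rightarrow> complex poly poly \<Rightarrow> complex poly poly" where
  "Phi_act lam \<alpha> \<beta> \<gamma> h x f = linear_ext scale_st (\<lambda>a. Phi_gen lam \<alpha> \<beta> \<gamma> h a f) x"

lemma vector_space_st: "vector_space scale_st"
  by unfold_locales (simp_all add: smult_add_right smult_add_left[symmetric] one_pCons[symmetric] mult.commute)

lemma Phi_act_single [simp]:
  "Phi_act lam \<alpha> \<beta> \<gamma> h (Poly_Mapping.single a 1) f = Phi_gen lam \<alpha> \<beta> \<gamma> h a f"
  by (simp add: Phi_act_def linear_ext_single[OF vector_space_st] one_pCons[symmetric])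

end

theory Submission
  imports Defs
begin

text \<open>
  Put \<open>q(t) = (h(t) - h(\<alpha>)) / (t - \<alpha>)\<close> and \<open>D = \<partial>/\<partial>t - q(t)\<close>, and let \<open>\<sigma>\<^sub>m\<close> be the shift
  \<open>f(s, t) \<mapsto> f(s - m, t)\<close>.  Substituting \<open>h = h(\<alpha>) + (t - \<alpha>) q\<close> gives
  \<open>h\<^sub>m = m (h(\<alpha>) + (t - m \<alpha>) q)\<close>, so \<open>h\<close> enters the action only through \<open>D\<close> and the number \<open>h(\<alpha>)\<close>:
  up to the factor \<open>lam\<^sup>m\<close>, the generators act by
  \<open>L\<^sub>m = (s + m h(\<alpha>) - m (t - m \<alpha>) D) \<sigma>\<^sub>m\<close>, \<open>M\<^sub>m = (t - m \<alpha>) \<sigma>\<^sub>m\<close>, \<open>S\<^sub>m = \<beta> \<sigma>\<^sub>m\<close> and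
  \<open>I\<^sub>m = (\<gamma> + m \<beta> D) \<sigma>\<^sub>m\<close>.  The commutation rules \<open>D t = t D + 1\<close> and \<open>\<sigma>\<^sub>m s = (s - m) \<sigma>\<^sub>m\<close>, all
  other pairs among \<open>s\<close>, \<open>t\<close>, \<open>D\<close>, \<open>\<sigma>\<^sub>m\<close> commuting, then turn each bracket relation into an identity
  between polynomial expressions in these operators (\<open>Phi_act_bracket_gen\<close>).

  If \<open>\<alpha> = \<beta> = 0\<close>, then \<open>D\<close> occurs only in the combination \<open>t D\<close>, so the multiples of \<open>t\<close> form a
  proper nonzero submodule.

  Suppose that \<open>\<alpha> \<noteq> 0\<close> or \<open>\<beta> \<noteq> 0\<close>, and let \<open>W\<close> be a nonzero submodule.  Since \<open>M\<^sub>0 = t\<close> and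
  \<open>L\<^sub>0 = s\<close>, it is an ideal of \<open>\<complex>[s, t]\<close>, and it suffices to find a nonzero constant in it.  Finite
  differences in \<open>m\<close> lower the degree.  On \<open>f\<close> of positive \<open>s\<close>-degree, the first difference of
  \<open>\<sigma>\<^sub>m f\<close> (if \<open>\<beta> \<noteq> 0\<close>) or the second difference of \<open>(t - m \<alpha>) \<sigma>\<^sub>m f\<close> (if \<open>\<alpha> \<noteq> 0\<close>) is nonzero of
  smaller \<open>s\<close>-degree (\<open>lower_s_degree\<close>); hence \<open>W\<close> contains a nonzero polynomial in \<open>t\<close> alone.  On
  such a polynomial \<open>\<sigma>\<^sub>m\<close> is the identity, so differences of \<open>I\<^sub>m\<close> or of \<open>L\<^sub>m\<close> produce \<open>\<beta> D\<close> or
  \<open>2 \<alpha> D\<close>; as \<open>W\<close> is an ideal, it is closed under \<open>\<partial>/\<partial>t\<close> there (\<open>pderiv_mem\<close>), and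
  differentiation ends in a nonzero constant.
\<close>

section \<open>Constants, shift and derivation on polynomials in two variables\<close>

text \<open>Scalars and the variable \<open>t\<close> are made opaque ring elements, so that operator identities become
  ring identities that the simplifier does not expand into coefficient lists.\<close>

definition const_st :: "complex \<Rightarrow> complex poly poly" where
  "const_st c = [:[:c:]:]"

definition t_var :: "complex poly poly" where
  "t_var = in_t [:0, 1:]"

lemma scale_st_eq_mult: "scale_st c f = const_st c * f"
  by (simp add: const_st_def)

lemma const_st_0 [simp]: "const_st 0 = 0"
  and const_st_1 [simp]: "const_st 1 = 1"
  and const_st_add: "const_st (a + b) = const_st a + const_st b"
  and const_st_diff: "const_st (a - b) = const_st a - const_st b"
  and const_st_minus: "const_st (- a) = - const_st a"
  and const_st_mult: "const_st (a * b) = const_st a * const_st b"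
  by (simp_all add: const_st_def one_pCons)

lemma const_st_of_int [simp]: "const_st (of_int m) = of_int m"
  by (simp add: const_st_def of_int_poly)

lemma linear_in_t: "in_t [:- of_int m * a, 1:] = t_var - of_int m * const_st a"
  unfolding const_st_of_int[symmetric] by (simp add: const_st_def t_var_def)

lemma shift_s_add: "shift_s m (f + g) = shift_s m f + shift_s m g"
  and shift_s_diff: "shift_s m (f - g) = shift_s m f - shift_s m g"
  and shift_s_mult: "shift_s m (f * g) = shift_s m f * shift_s m g"
  and shift_s_in_t [simp]: "shift_s m (in_t p) = in_t p"
  and shift_s_zero [simp]: "shift_s 0 f = f"
  by (simp_all add: shift_s_def pcompose_add pcompose_diff pcompose_mult pcompose_idR)

lemma shift_s_const_st [simp]: "shift_s m (const_st c) = const_st c"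
  and shift_s_t_var [simp]: "shift_s m t_var = t_var"
  by (simp_all add: const_st_def t_var_def)

lemma shift_s_of_int [simp]: "shift_s m (of_int n) = of_int n"
  unfolding const_st_of_int[symmetric] by (rule shift_s_const_st)

lemma shift_s_s_var [simp]: "shift_s m s_var = s_var - of_int m"
  by (simp add: shift_s_def pcompose_pCons)

lemma pCons_eq_s_var: "pCons a p = in_t a + s_var * p"
  by simp

lemma shift_s_shift_s [simp]: "shift_s m (shift_s n f) = shift_s (n + m) f"
proof (induction f)
  case 0 then show ?case by (simp add: shift_s_def)
next
  case (pCons a p) then show ?case
    unfolding pCons_eq_s_var[of a p]
    by (simp only: shift_s_add shift_s_mult shift_s_diff shift_s_in_t
        shift_s_s_var shift_s_of_int of_int_add diff_diff_add) (simp add: algebra_simps)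
qed

lemma deriv_t_0 [simp]: "deriv_t 0 = 0"
  and deriv_t_pCons: "deriv_t (pCons a p) = pCons (pderiv a) (deriv_t p)"
  by (simp_all add: deriv_t_def map_poly_pCons)

lemma deriv_t_add: "deriv_t (f + g) = deriv_t f + deriv_t g"
  by (rule poly_eqI) (simp add: deriv_t_def coeff_map_poly pderiv_add)

lemma deriv_t_diff: "deriv_t (f - g) = deriv_t f - deriv_t g"
  by (rule poly_eqI) (simp add: deriv_t_def coeff_map_poly pderiv_diff)

lemma deriv_t_smult: "deriv_t (smult a g) = smult (pderiv a) g + smult a (deriv_t g)"
  by (rule poly_eqI) (simp add: deriv_t_def coeff_map_poly pderiv_mult algebra_simps)

lemma deriv_t_mult: "deriv_t (f * g) = deriv_t f * g + f * deriv_t g"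
proof (induction f)
  case (pCons a p)
  then show ?case
    by (simp add: deriv_t_pCons deriv_t_add deriv_t_smult algebra_simps)
qed simp

lemma deriv_t_s_var [simp]: "deriv_t s_var = 0"
  and deriv_t_t_var [simp]: "deriv_t t_var = 1"
  and deriv_t_const_st [simp]: "deriv_t (const_st c) = 0"
  and deriv_t_in_t: "deriv_t (in_t p) = in_t (pderiv p)"
  by (simp_all add: t_var_def const_st_def deriv_t_pCons pderiv_pCons one_pCons pderiv_1)

lemma deriv_t_of_int [simp]: "deriv_t (of_int n) = 0"
  unfolding const_st_of_int[symmetric] by (rule deriv_t_const_st)

lemma deriv_t_shift_s: "deriv_t (shift_s m f) = shift_s m (deriv_t f)"
proof (induction f)
  case 0 then show ?case by (simp add: shift_s_def)
next
  case (pCons a p) then show ?case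
    unfolding pCons_eq_s_var[of a p]
    by (simp only: shift_s_add shift_s_mult shift_s_in_t shift_s_s_var
        deriv_t_add deriv_t_mult deriv_t_in_t deriv_t_s_var deriv_t_diff deriv_t_of_int mult_zero_left add_0_left diff_self)
qed

section \<open>The twisted derivation and the normal form of the generators\<close>

text \<open>If \<open>Q' = q\<close>, this is \<open>\<partial>/\<partial>t\<close> conjugated by \<open>exp Q\<close>; it therefore obeys the same commutation
  rules as \<open>\<partial>/\<partial>t\<close>.\<close>

definition twisted_deriv :: "complex \<Rightarrow> complex poly \<Rightarrow> complex poly poly \<Rightarrow> complex poly poly" where
  "twisted_deriv \<alpha> h f = deriv_t f - in_t (diff_quot \<alpha> h) * f"

lemma twisted_deriv_add: "twisted_deriv \<alpha> h (f + g) = twisted_deriv \<alpha> h f + twisted_deriv \<alpha> h g"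
  and twisted_deriv_diff: "twisted_deriv \<alpha> h (f - g) = twisted_deriv \<alpha> h f - twisted_deriv \<alpha> h g"
  and twisted_deriv_s_var: "twisted_deriv \<alpha> h (s_var * f) = s_var * twisted_deriv \<alpha> h f"
  and twisted_deriv_t_var: "twisted_deriv \<alpha> h (t_var * f) = t_var * twisted_deriv \<alpha> h f + f"
  and twisted_deriv_const_st:
    "twisted_deriv \<alpha> h (const_st c * f) = const_st c * twisted_deriv \<alpha> h f"
  and twisted_deriv_of_int: "twisted_deriv \<alpha> h (of_int n * f) = of_int n * twisted_deriv \<alpha> h f"
  unfolding twisted_deriv_def deriv_t_add deriv_t_diff deriv_t_mult deriv_t_s_var deriv_t_t_var
    deriv_t_const_st deriv_t_of_int
  by (simp_all only: mult_zero_left) (simp_all only: algebra_simps add_0_left mult_1_left mult_1_right)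

lemma twisted_deriv_shift_s: "twisted_deriv \<alpha> h (shift_s m f) = shift_s m (twisted_deriv \<alpha> h f)"
  unfolding twisted_deriv_def shift_s_diff shift_s_mult shift_s_in_t deriv_t_shift_s ..

text \<open>Exact division makes \<open>h = h(\<alpha>) + (t - \<alpha>) q\<close>, and \<open>m (t - \<alpha>) - m (m - 1) \<alpha> = m (t - m \<alpha>)\<close>.
  This is why the zeroth-order term of \<open>L\<^sub>m\<close> combines with its derivative term into the twisted
  derivation.\<close>

lemma h_poly_eq:
  "h_poly \<alpha> h m = smult (of_int m) ([:poly h \<alpha>:] + [:- of_int m * \<alpha>, 1:] * diff_quot \<alpha> h)"
proof -
  have h: "h = [:poly h \<alpha>:] + [:- \<alpha>, 1:] * diff_quot \<alpha> h"
    by (simp only: diff_quot_mult) simp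
  have "h_poly \<alpha> h m = smult (of_int m) ([:poly h \<alpha>:] + [:- \<alpha>, 1:] * diff_quot \<alpha> h)
      - smult (of_int (m * (m - 1)) * \<alpha>) (diff_quot \<alpha> h)"
    unfolding h_poly_def by (subst h[symmetric]) simp
  also have "\<dots> = smult (of_int m) ([:poly h \<alpha>:] + [:- of_int m * \<alpha>, 1:] * diff_quot \<alpha> h)"
    by (rule poly_eqI) (simp add: algebra_simps coeff_pCons split: nat.splits)
  finally show ?thesis .
qed

lemma Phi_gen_L:
  "Phi_gen lam \<alpha> \<beta> \<gamma> h (L m) f = const_st (lam powi m) *
     ((s_var + of_int m * const_st (poly h \<alpha>)) * shift_s m f
      - of_int m * ((t_var - of_int m * const_st \<alpha>) * twisted_deriv \<alpha> h (shift_s m f)))"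
proof -
  have "in_t (h_poly \<alpha> h m) = of_int m * (const_st (poly h \<alpha>)
      + (t_var - of_int m * const_st \<alpha>) * in_t (diff_quot \<alpha> h))"
    unfolding h_poly_eq linear_in_t[symmetric]
    unfolding const_st_of_int[symmetric] const_st_def by simp
  note h = this
  show ?thesis
    unfolding Phi_gen.simps h scale_st_eq_mult linear_in_t const_st_mult const_st_of_int
      twisted_deriv_def
    by (simp only: algebra_simps)
qed

lemma Phi_gen_M:
  "Phi_gen lam \<alpha> \<beta> \<gamma> h (M m) f =
     const_st (lam powi m) * ((t_var - of_int m * const_st \<alpha>) * shift_s m f)"
  unfolding Phi_gen.simps scale_st_eq_mult linear_in_t ..

lemma Phi_gen_S:
  "Phi_gen lam \<alpha> \<beta> \<gamma> h (S m) f = const_st (lam powi m) * (const_st \<beta> * shift_s m f)"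
  unfolding Phi_gen.simps scale_st_eq_mult const_st_mult by (simp only: mult.assoc)

lemma Phi_gen_I:
  "Phi_gen lam \<alpha> \<beta> \<gamma> h (I m) f = const_st (lam powi m) *
     (const_st \<gamma> * shift_s m f + of_int m * (const_st \<beta> * twisted_deriv \<alpha> h (shift_s m f)))"
proof -
  have "in_t ([:\<gamma>:] - smult (of_int m * \<beta>) (diff_quot \<alpha> h))
      = const_st \<gamma> - of_int m * (const_st \<beta> * in_t (diff_quot \<alpha> h))"
    unfolding const_st_of_int[symmetric] const_st_def by simp
  note i = this
  show ?thesis
    unfolding Phi_gen.simps i scale_st_eq_mult const_st_mult const_st_of_int twisted_deriv_def
    by (simp only: algebra_simps)
qed

lemmas Phi_gen_normal = Phi_gen_L Phi_gen_M Phi_gen_S Phi_gen_I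

section \<open>The module structure\<close>

text \<open>These rules move every shift and every twisted derivation to the right, onto the argument \<open>f\<close>.\<close>

lemmas operator_simps =
  shift_s_add shift_s_diff shift_s_mult shift_s_const_st shift_s_t_var shift_s_s_var shift_s_of_int
  shift_s_shift_s twisted_deriv_shift_s[symmetric]
  twisted_deriv_add twisted_deriv_diff twisted_deriv_s_var twisted_deriv_t_var
  twisted_deriv_const_st twisted_deriv_of_int

lemma Phi_gen_add: "Phi_gen lam \<alpha> \<beta> \<gamma> h a (f + g) = Phi_gen lam \<alpha> \<beta> \<gamma> h a f + Phi_gen lam \<alpha> \<beta> \<gamma> h a g"
  by (cases a) (simp_all only: Phi_gen_normal shift_s_add twisted_deriv_add, simp_all only: algebra_simps)

lemma Phi_gen_scale: "Phi_gen lam \<alpha> \<beta> \<gamma> h a (const_st c * f) = const_st c * Phi_gen lam \<alpha> \<beta> \<gamma> h a f"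
  by (cases a) (simp_all only: Phi_gen_normal shift_s_mult shift_s_const_st twisted_deriv_const_st,
      simp_all only: algebra_simps)

lemma linear_Phi_act_left: "Vector_Spaces.linear bms_scale scale_st (\<lambda>x. Phi_act lam \<alpha> \<beta> \<gamma> h x f)"
  unfolding Phi_act_def by (rule linear_linear_ext[OF vector_space_st])

lemma Phi_act_add_left:
    "Phi_act lam \<alpha> \<beta> \<gamma> h (x + y) f = Phi_act lam \<alpha> \<beta> \<gamma> h x f + Phi_act lam \<alpha> \<beta> \<gamma> h y f"
  and Phi_act_scale_left:
    "Phi_act lam \<alpha> \<beta> \<gamma> h (bms_scale c x) f = const_st c * Phi_act lam \<alpha> \<beta> \<gamma> h x f"
  using linear_Phi_act_left[THEN Vector_Spaces.linear.axioms(3), THEN module_hom.add]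
    linear_Phi_act_left[THEN Vector_Spaces.linear.axioms(3), THEN module_hom.scale]
  by (simp_all only: scale_st_eq_mult)

lemma Phi_act_0_left [simp]: "Phi_act lam \<alpha> \<beta> \<gamma> h 0 f = 0"
  by (simp add: Phi_act_def linear_ext_def)

lemma Phi_act_minus_left: "Phi_act lam \<alpha> \<beta> \<gamma> h (- x) f = - Phi_act lam \<alpha> \<beta> \<gamma> h x f"
  using Phi_act_add_left[of lam \<alpha> \<beta> \<gamma> h "- x" x f] by (simp add: eq_neg_iff_add_eq_0)

lemma Phi_act_single_scaled:
  "Phi_act lam \<alpha> \<beta> \<gamma> h (Poly_Mapping.single a c) f = const_st c * Phi_gen lam \<alpha> \<beta> \<gamma> h a f"
  by (simp add: Phi_act_def linear_ext_single[OF vector_space_st] scale_st_eq_mult del: Phi_gen.simps)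

lemma Phi_act_add_right:
  "Phi_act lam \<alpha> \<beta> \<gamma> h x (f + g) = Phi_act lam \<alpha> \<beta> \<gamma> h x f + Phi_act lam \<alpha> \<beta> \<gamma> h x g"
  by (simp add: Phi_act_def linear_ext_def Phi_gen_add smult_add_right sum.distrib)

lemma Phi_act_scale_right:
  "Phi_act lam \<alpha> \<beta> \<gamma> h x (const_st c * f) = const_st c * Phi_act lam \<alpha> \<beta> \<gamma> h x f"
  unfolding Phi_act_def linear_ext_def Phi_gen_scale scale_st_eq_mult sum_distrib_left
  by (simp only: mult.left_commute)

text \<open>In normal form both sides are combinations of \<open>D\<^sup>i \<sigma>\<^bsub>m+n\<^esub> f\<close> with coefficients in \<open>\<complex>[s, t]\<close>, so
  commuting all operators to the right reduces every pair of generators to commutative algebra.\<close>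

lemma Phi_act_bracket_gen:
  assumes "lam \<noteq> 0"
  shows "Phi_act lam \<alpha> \<beta> \<gamma> h (bms_bracket_gen a b) f =
     Phi_gen lam \<alpha> \<beta> \<gamma> h a (Phi_gen lam \<alpha> \<beta> \<gamma> h b f)
     - Phi_gen lam \<alpha> \<beta> \<gamma> h b (Phi_gen lam \<alpha> \<beta> \<gamma> h a f)"
proof -
  have powi: "const_st (lam powi (m + n)) = const_st (lam powi m) * const_st (lam powi n)" for m n
    using assms by (simp add: power_int_add const_st_mult)
  show ?thesis
    \<comment> \<open>The first pass must keep the factors in order: the operator rules match products of the form
      variable times argument, which commutativity would break up.\<close>
    by (cases a; cases b)
      (simp_all only: bms_bracket_gen.simps Phi_act_0_left Phi_act_minus_left Phi_act_single_scaled
          Phi_gen_normal operator_simps powi const_st_of_int const_st_minus const_st_diff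
          of_int_add of_int_diff of_int_minus left_diff_distrib distrib_right mult.assoc
          mult_minus_left mult_minus_right minus_diff_eq minus_minus,
        simp_all only: algebra_simps add_0_left add_0_right mult_minus_left mult_minus_right
          minus_diff_eq minus_minus uminus_add_conv_diff add_uminus_conv_diff)
qed

lemma lie_module_Phi:
  assumes "lam \<noteq> 0"
  shows "lie_module bms_scale bms_bracket scale_st (Phi_act lam \<alpha> \<beta> \<gamma> h)"
proof -
  interpret B: lie_algebra bms_scale bms_bracket by (rule lie_algebra_bms)
  interpret V: vector_space scale_st by (rule vector_space_st)
  have linear_bracket:
      "bms_bracket (x + x') y = bms_bracket x y + bms_bracket x' y"
      "bms_bracket (bms_scale c x) y = bms_scale c (bms_bracket x y)"
      "bms_bracket y (x + x') = bms_bracket y x + bms_bracket y x'"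
      "bms_bracket y (bms_scale c x) = bms_scale c (bms_bracket y x)" for x x' y c
    using module_hom.add[OF B.linear_left[THEN Vector_Spaces.linear.axioms(3)]]
      module_hom.scale[OF B.linear_left[THEN Vector_Spaces.linear.axioms(3)]]
      module_hom.add[OF B.linear_right[THEN Vector_Spaces.linear.axioms(3)]]
      module_hom.scale[OF B.linear_right[THEN Vector_Spaces.linear.axioms(3)]]
    by blast+
  have zero_bracket: "bms_bracket 0 y = 0" "bms_bracket y 0 = 0" for y
    using linear_bracket(1)[of 0 0 y] linear_bracket(3)[of y 0 0] by simp_all
  have zero_right: "Phi_act lam \<alpha> \<beta> \<gamma> h x 0 = 0" for x
    using Phi_act_add_right[of lam \<alpha> \<beta> \<gamma> h x 0 0] by simp
  note bilinear = linear_bracket zero_bracket zero_right Phi_act_0_left Phi_act_add_left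
    Phi_act_add_right Phi_act_scale_left Phi_act_scale_right
  have bracket: "Phi_act lam \<alpha> \<beta> \<gamma> h (bms_bracket x y) v =
      Phi_act lam \<alpha> \<beta> \<gamma> h x (Phi_act lam \<alpha> \<beta> \<gamma> h y v)
      - Phi_act lam \<alpha> \<beta> \<gamma> h y (Phi_act lam \<alpha> \<beta> \<gamma> h x v)" for x y v
  proof (induction x rule: bms_induct)
    case (gen a)
    show ?case
    proof (induction y rule: bms_induct)
      case (gen b)
      show ?case
        unfolding bms_bracket_single Phi_act_single by (rule Phi_act_bracket_gen[OF assms])
    qed (simp_all only: bilinear right_diff_distrib diff_self, simp_all only: algebra_simps)
  qed (simp_all only: bilinear right_diff_distrib diff_self, simp_all only: algebra_simps)
  have linear_right: "Vector_Spaces.linear scale_st scale_st (Phi_act lam \<alpha> \<beta> \<gamma> h x)" for x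
    by unfold_locales (simp_all only: Phi_act_add_right scale_st_eq_mult Phi_act_scale_right)
  show ?thesis
    by (intro lie_module.intro lie_module_axioms.intro lie_algebra_bms vector_space_st
        linear_Phi_act_left linear_right bracket)
qed

section \<open>Submodules\<close>

lemma subspace_st_iff:
  "module.subspace scale_st W \<longleftrightarrow>
     0 \<in> W \<and> (\<forall>f\<in>W. \<forall>g\<in>W. f + g \<in> W) \<and> (\<forall>c. \<forall>f\<in>W. const_st c * f \<in> W)"
proof -
  interpret V: vector_space scale_st by (rule vector_space_st)
  show ?thesis unfolding V.subspace_def scale_st_eq_mult by blast
qed

lemma lie_submodule_Phi_iff:
  "lie_submodule scale_st (Phi_act lam \<alpha> \<beta> \<gamma> h) W \<longleftrightarrow>
     module.subspace scale_st W \<and> (\<forall>a. \<forall>f\<in>W. Phi_gen lam \<alpha> \<beta> \<gamma> h a f \<in> W)"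
proof -
  have "Phi_act lam \<alpha> \<beta> \<gamma> h x f \<in> W"
    if "module.subspace scale_st W" "\<forall>a. \<forall>f\<in>W. Phi_gen lam \<alpha> \<beta> \<gamma> h a f \<in> W" "f \<in> W" for x f
  proof (induction x rule: bms_induct)
    case (gen a)
    then show ?case using that(2,3) by (simp only: Phi_act_single)
  qed (use that(1) in \<open>simp_all add: subspace_st_iff Phi_act_add_left Phi_act_scale_left\<close>)
  moreover have "Phi_gen lam \<alpha> \<beta> \<gamma> h a f \<in> W"
    if "\<forall>x. \<forall>f\<in>W. Phi_act lam \<alpha> \<beta> \<gamma> h x f \<in> W" "f \<in> W" for a f
    using that Phi_act_single[of lam \<alpha> \<beta> \<gamma> h a f] by metis
  ultimately show ?thesis
    unfolding lie_submodule_def by blast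
qed

text \<open>Only \<open>L\<^sub>m\<close> needs an argument: with \<open>\<alpha> = 0\<close> the derivation comes with a factor \<open>t\<close>, so whatever it
  does to \<open>t f\<close> is multiplied back into a multiple of \<open>t\<close>.\<close>

lemma lie_submodule_multiples_of_t:
  "lie_submodule scale_st (Phi_act lam 0 0 \<gamma> h) (range ((*) t_var))"
  unfolding lie_submodule_Phi_iff
proof (intro conjI allI ballI)
  have "0 = t_var * 0" "t_var * f + t_var * g = t_var * (f + g)"
    "const_st c * (t_var * f) = t_var * (const_st c * f)" for c f g
    by (simp_all only: algebra_simps mult_zero_left mult_zero_right)
  then show "module.subspace scale_st (range ((*) t_var))"
    unfolding subspace_st_iff by blast
  fix a w
  assume "w \<in> range ((*) t_var)"
  then obtain f where w: "w = t_var * f" by blast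
  show "Phi_gen lam 0 0 \<gamma> h a w \<in> range ((*) t_var)"
  proof (cases a)
    case (L m)
    have "Phi_gen lam 0 0 \<gamma> h a w = t_var * (const_st (lam powi m) *
        ((s_var + of_int m * const_st (poly h 0)) * shift_s m f
         - of_int m * twisted_deriv 0 h (t_var * shift_s m f)))"
      unfolding L w Phi_gen_L const_st_0 shift_s_mult shift_s_t_var mult_zero_right diff_0_right
      by (simp only: algebra_simps)
    then show ?thesis by blast
  next
    case (M m)
    have "Phi_gen lam 0 0 \<gamma> h a w = t_var * (const_st (lam powi m) * (t_var * shift_s m f))"
      unfolding M w Phi_gen_M const_st_0 shift_s_mult shift_s_t_var mult_zero_right diff_0_right
      by (simp only: algebra_simps)
    then show ?thesis by blast
  next
    case (S m)
    have "Phi_gen lam 0 0 \<gamma> h a w = t_var * 0"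
      unfolding S Phi_gen_S by simp
    then show ?thesis by blast
  next
    case (I m)
    have "Phi_gen lam 0 0 \<gamma> h a w = t_var * (const_st (lam powi m) * (const_st \<gamma> * shift_s m f))"
      unfolding I w Phi_gen_I const_st_0 shift_s_mult shift_s_t_var mult_zero_right mult_zero_left
        add_0_right
      by (simp only: algebra_simps)
    then show ?thesis by blast
  qed
qed

lemma one_not_multiple_of_t: "1 \<notin> range ((*) t_var)"
proof
  assume "1 \<in> range ((*) t_var)"
  then obtain f where "t_var * f = 1" by auto
  then have "poly (coeff (t_var * f) 0) 0 = 1" by simp
  then show False by (simp add: t_var_def)
qed

lemma not_irreducible_Phi: "\<not> irreducible_lie_module scale_st (Phi_act lam 0 0 \<gamma> h)"
proof
  assume "irreducible_lie_module scale_st (Phi_act lam 0 0 \<gamma> h)"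
  then have "range ((*) t_var) = {0} \<or> range ((*) t_var) = UNIV"
    using lie_submodule_multiples_of_t unfolding irreducible_lie_module_def by blast
  moreover have "t_var * 1 \<noteq> 0" by (simp add: t_var_def)
  ultimately show False using one_not_multiple_of_t by blast
qed

lemma degree_shift_s: "degree (shift_s m f) = degree f"
proof -
  have "s_var - of_int m = [:- of_int m, 1:]"
    by (simp add: of_int_poly)
  then show ?thesis
    unfolding shift_s_def by (simp add: degree_pcompose)
qed

lemma shift_s_pCons:
  "shift_s m (pCons a p) = pCons a (shift_s m p) - smult (of_int m) (shift_s m p)"
proof -
  have "of_int m * shift_s m p = smult (of_int m) (shift_s m p)"
    by (simp add: of_int_poly)
  then show ?thesis
    unfolding pCons_eq_s_var[of a p] shift_s_add shift_s_mult shift_s_in_t shift_s_s_var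
      left_diff_distrib
    by simp
qed

lemma coeff_shift_s_top:
  "degree f \<le> n \<Longrightarrow> coeff (shift_s m f) n = coeff f n"
proof (induction f arbitrary: n)
  case 0
  then show ?case by (simp add: shift_s_def)
next
  case (pCons a p)
  show ?case
  proof (cases "p = 0")
    case False
    then obtain k where k: "n = Suc k" "degree p \<le> k"
      using pCons.prems by (cases n) auto
    then have "coeff (shift_s m p) (Suc k) = 0"
      by (intro coeff_eq_0) (simp add: degree_shift_s)
    then show ?thesis
      using k pCons.IH[of k] by (simp add: shift_s_pCons)
  qed (simp add: shift_s_pCons, simp add: shift_s_def)
qed

text \<open>The first two terms of the Taylor expansion \<open>f(s - m) = f(s) - m f'(s) + \<dots>\<close>: together with
  the top coefficient, this shows how differences in \<open>m\<close> lower the degree.\<close>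

lemma coeff_shift_s_subtop:
  "degree f \<le> Suc n \<Longrightarrow>
    coeff (shift_s m f) n = coeff f n - of_int m * of_nat (Suc n) * coeff f (Suc n)"
proof (induction f arbitrary: n)
  case 0
  then show ?case by (simp add: shift_s_def)
next
  case (pCons a p)
  have deg: "degree p \<le> n"
    using pCons.prems by (auto split: if_splits)
  show ?case
  proof (cases n)
    case 0
    then show ?thesis using coeff_shift_s_top[OF deg] by (simp add: shift_s_pCons)
  next
    case (Suc k)
    then show ?thesis
      using coeff_shift_s_top[OF deg] pCons.IH[of k] deg by (simp add: shift_s_pCons algebra_simps)
  qed
qed

locale Phi_submodule =
  fixes lam \<alpha> \<beta> \<gamma> :: complex and h :: "complex poly" and W
  assumes lam_nonzero: "lam \<noteq> 0"
    and submodule: "lie_submodule scale_st (Phi_act lam \<alpha> \<beta> \<gamma> h) W"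
begin

lemma zero_mem: "0 \<in> W"
  and add_mem: "f \<in> W \<Longrightarrow> g \<in> W \<Longrightarrow> f + g \<in> W"
  and const_mem: "f \<in> W \<Longrightarrow> const_st c * f \<in> W"
  and gen_mem: "f \<in> W \<Longrightarrow> Phi_gen lam \<alpha> \<beta> \<gamma> h a f \<in> W"
  using submodule unfolding lie_submodule_Phi_iff subspace_st_iff by blast+

lemma diff_mem: "f \<in> W \<Longrightarrow> g \<in> W \<Longrightarrow> f - g \<in> W"
  using add_mem[of f "const_st (-1) * g"] const_mem[of g "-1"] by (simp add: const_st_minus)

lemma const_mem_cancel:
  assumes "const_st c * f \<in> W" "c \<noteq> 0"
  shows "f \<in> W"
  using const_mem[OF assms(1), of "1 / c"] assms(2)
  by (simp only: mult.assoc[symmetric] const_st_mult[symmetric]) simp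

lemma power_mem_cancel: "const_st (lam powi m) * f \<in> W \<Longrightarrow> f \<in> W"
  by (erule const_mem_cancel) (simp add: lam_nonzero)

lemma M_mem: "f \<in> W \<Longrightarrow> (t_var - of_int m * const_st \<alpha>) * shift_s m f \<in> W"
  using gen_mem[of f "M m"] unfolding Phi_gen_M by (rule power_mem_cancel)

lemma t_var_mem: "f \<in> W \<Longrightarrow> t_var * f \<in> W"
  using M_mem[of f 0] by simp

lemma s_var_mem: "f \<in> W \<Longrightarrow> s_var * f \<in> W"
  using gen_mem[of f "L 0"] unfolding Phi_gen_L by simp

lemma in_t_mult_mem:
  assumes "f \<in> W"
  shows "in_t p * f \<in> W"
proof (induction p)
  case 0 then show ?case by (simp add: zero_mem)
next
  case (pCons c p)
  have "in_t (pCons c p) * f = const_st c * f + t_var * (in_t p * f)"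
    by (simp add: const_st_def t_var_def smult_add_left[symmetric])
  then show ?case
    using pCons.IH assms by (simp only: add_mem const_mem t_var_mem)
qed

lemma ideal:
  assumes "f \<in> W"
  shows "g * f \<in> W"
proof (induction g)
  case 0 then show ?case by (simp add: zero_mem)
next
  case (pCons p g)
  have eq: "pCons p g * f = in_t p * f + s_var * (g * f)"
    by simp
  show ?case
    unfolding eq by (intro add_mem in_t_mult_mem s_var_mem assms pCons.IH)
qed

lemma shift_mem:
  assumes "\<beta> \<noteq> 0" "f \<in> W"
  shows "shift_s m f \<in> W"
proof -
  have "const_st \<beta> * shift_s m f \<in> W"
    using gen_mem[OF assms(2), of "S m"] unfolding Phi_gen_S by (rule power_mem_cancel)
  then show ?thesis using assms(1) by (rule const_mem_cancel)
qed

text \<open>Let \<open>a\<close> be the leading coefficient of \<open>f\<close>, in degree \<open>n + 1\<close>.  If \<open>\<beta> \<noteq> 0\<close>, the shift is available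
  on \<open>W\<close> and \<open>\<sigma>\<^sub>1 f - f\<close> has coefficient \<open>- (n + 1) a\<close> in degree \<open>n\<close>.  Otherwise the shift comes only
  with the factor \<open>t - m \<alpha>\<close>; the coefficients of \<open>(t - m \<alpha>) \<sigma>\<^sub>m f\<close> in degrees \<open>n + 1\<close> and \<open>n\<close> are of
  degree 1 and 2 in \<open>m\<close>, so the second difference at \<open>m = -1, 0, 1\<close> kills the former and leaves
  \<open>2 \<alpha> (n + 1) a\<close> in the latter.\<close>

lemma lower_s_degree:
  assumes "\<alpha> \<noteq> 0 \<or> \<beta> \<noteq> 0" "f \<in> W" "degree f = Suc n"
  obtains g where "g \<in> W" "g \<noteq> 0" "degree g \<le> n"
proof -
  have top: "coeff f (Suc n) \<noteq> 0"
    using assms(3) by (metis leading_coeff_0_iff degree_0 nat.distinct(1))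
  have deg: "degree (shift_s m f) = Suc n" for m
    using assms(3) by (simp add: degree_shift_s)
  note shift = coeff_shift_s_top[OF eq_refl[OF assms(3)]]
    coeff_shift_s_subtop[OF eq_refl[OF assms(3)]]
  note result = that
  have lower: thesis
    if g: "g \<in> W" "degree g \<le> Suc n" "coeff g (Suc n) = 0" "coeff g n \<noteq> 0" for g
  proof (rule result)
    have "coeff g i = 0" if "n < i" for i
      using g(2,3) that coeff_eq_0[of g i] by (cases "i = Suc n") auto
    then show "degree g \<le> n" by (intro degree_le) blast
  qed (use g in auto)
  show thesis
  proof (cases "\<beta> = 0")
    case False
    show thesis
    proof (rule lower)
      show "shift_s 1 f - f \<in> W" by (intro diff_mem shift_mem False assms)
      show "degree (shift_s 1 f - f) \<le> Suc n" by (intro degree_diff_le) (simp_all add: deg assms)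
    qed (use top in \<open>simp_all add: shift del: of_nat_Suc\<close>)
  next
    case True
    define p q where "p = [:- \<alpha>, 1:]" and "q = [:\<alpha>, 1:]"
    let ?g = "in_t p * shift_s 1 f + in_t q * shift_s (-1) f - in_t (p + q) * f"
    show thesis
    proof (rule lower)
      show "?g \<in> W"
      proof (rule diff_mem[OF add_mem in_t_mult_mem[OF assms(2)]])
        show "in_t p * shift_s 1 f \<in> W"
          using M_mem[OF assms(2), of 1] unfolding linear_in_t[symmetric] by (simp add: p_def)
        show "in_t q * shift_s (-1) f \<in> W"
          using M_mem[OF assms(2), of "-1"] unfolding linear_in_t[symmetric] by (simp add: q_def)
      qed
      show "degree ?g \<le> Suc n"
        by (intro degree_diff_le degree_add_le order.trans[OF degree_mult_le]) (simp_all add: deg assms)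
      show "coeff ?g (Suc n) = 0"
        by (simp add: shift algebra_simps)
      have "coeff ?g n = (q - p) * (of_nat (Suc n) * coeff f (Suc n))"
        by (simp add: shift algebra_simps)
      then show "coeff ?g n \<noteq> 0"
        using True assms(1) top by (simp add: p_def q_def del: of_nat_Suc)
    qed
  qed
qed

text \<open>Without the shift the operators \<open>I\<^sub>m\<close> and \<open>L\<^sub>m\<close> are polynomial in \<open>m\<close>.  The linear coefficient of
  the former is \<open>\<beta> D\<close> and the quadratic one of the latter is \<open>\<alpha> D\<close>, so one of them puts \<open>D p\<close> into
  \<open>W\<close>; \<open>D p\<close> differs from \<open>p'\<close> by the multiple \<open>q p\<close> of \<open>p\<close>.\<close>

lemma pderiv_mem:
  assumes "\<alpha> \<noteq> 0 \<or> \<beta> \<noteq> 0" "in_t p \<in> W"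
  shows "in_t (pderiv p) \<in> W"
proof -
  let ?f = "in_t p"
  let ?D = "twisted_deriv \<alpha> h ?f"
  have "?D \<in> W"
  proof (cases "\<beta> = 0")
    case False
    have "const_st \<gamma> * ?f + of_int 1 * (const_st \<beta> * ?D) \<in> W"
      using gen_mem[OF assms(2), of "I 1"] unfolding Phi_gen_I shift_s_in_t by (rule power_mem_cancel)
    from diff_mem[OF this const_mem[OF assms(2), of \<gamma>]] have "const_st \<beta> * ?D \<in> W" by simp
    then show ?thesis using False by (rule const_mem_cancel)
  next
    case True
    define X where "X m = (s_var + of_int m * const_st (poly h \<alpha>)) * ?f
      - of_int m * ((t_var - of_int m * const_st \<alpha>) * ?D)" for m
    have X: "X m \<in> W" for m
      using gen_mem[OF assms(2), of "L m"] unfolding Phi_gen_L shift_s_in_t X_def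
      by (rule power_mem_cancel)
    have second_difference: "(a + a) * d = ((s + 1 * c) * f - 1 * ((t - 1 * a) * d))
        + ((s + - 1 * c) * f - - 1 * ((t - - 1 * a) * d))
        - ((s + 0 * c) * f - 0 * ((t - 0 * a) * d) + ((s + 0 * c) * f - 0 * ((t - 0 * a) * d)))"
      for a c d f s t :: "complex poly poly"
      by (simp add: algebra_simps)
    have "const_st (2 * \<alpha>) * ?D = X 1 + X (-1) - (X 0 + X 0)"
      unfolding mult_2 const_st_add X_def of_int_1 of_int_0 of_int_minus by (rule second_difference)
    also have "\<dots> \<in> W" by (intro diff_mem add_mem X)
    finally show ?thesis by (rule const_mem_cancel) (use True assms(1) in simp)
  qed
  moreover have "in_t (pderiv p) = ?D + in_t (diff_quot \<alpha> h) * ?f"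
    unfolding twisted_deriv_def deriv_t_in_t by simp
  ultimately show ?thesis
    using assms(2) by (simp only: add_mem in_t_mult_mem)
qed

lemma eq_UNIV:
  assumes "\<alpha> \<noteq> 0 \<or> \<beta> \<noteq> 0" "W \<noteq> {0}"
  shows "W = UNIV"
proof -
  have "\<exists>p. in_t p \<in> W \<and> p \<noteq> 0" if "f \<in> W" "f \<noteq> 0" for f
    using that
  proof (induction "degree f" arbitrary: f rule: less_induct)
    case less
    show ?case
    proof (cases "degree f")
      case 0
      then show ?thesis using less.prems by (metis degree_0_id pCons_eq_0_iff)
    next
      case (Suc n)
      then obtain g where "g \<in> W" "g \<noteq> 0" "degree g \<le> n"
        using lower_s_degree assms(1) less.prems(1) by metis
      then show ?thesis using less.hyps[of g] Suc by simp
    qed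
  qed
  then obtain p where p: "in_t p \<in> W" "p \<noteq> 0"
    using assms(2) zero_mem by auto
  have "\<exists>c. const_st c \<in> W \<and> c \<noteq> 0"
    using p
  proof (induction "degree p" arbitrary: p rule: less_induct)
    case less
    show ?case
    proof (cases "degree p")
      case 0
      then obtain c where "p = [:c:]" by (metis degree_0_id)
      then show ?thesis using less.prems by (auto simp: const_st_def)
    next
      case (Suc n)
      then have "degree (pderiv p) = n" "pderiv p \<noteq> 0"
        by (simp_all add: degree_pderiv pderiv_eq_0_iff)
      then show ?thesis
        using less.hyps[of "pderiv p"] pderiv_mem assms(1) less.prems(1) Suc by simp
    qed
  qed
  then obtain c where c: "const_st c \<in> W" "c \<noteq> 0" by blast
  then have "1 \<in> W"
    using const_mem_cancel[of c 1] by simp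
  then show ?thesis
    using ideal[of 1] by auto
qed

end

lemma irreducible_Phi:
  assumes "lam \<noteq> 0" "\<alpha> \<noteq> 0 \<or> \<beta> \<noteq> 0"
  shows "irreducible_lie_module scale_st (Phi_act lam \<alpha> \<beta> \<gamma> h)"
  unfolding irreducible_lie_module_def
proof (intro conjI allI impI)
  show "\<exists>f :: complex poly poly. f \<noteq> 0" by (rule exI[of _ 1]) simp
  fix W
  assume "lie_submodule scale_st (Phi_act lam \<alpha> \<beta> \<gamma> h) W"
  with assms(1) interpret Phi_submodule lam \<alpha> \<beta> \<gamma> h W by unfold_locales
  show "W = {0} \<or> W = UNIV" using eq_UNIV[OF assms(2)] by blast
qed

theorem proposition2p3:
  fixes lam \<alpha> \<beta> \<gamma> :: complex and h :: "complex poly"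
  assumes "lam \<noteq> 0"
  shows "lie_module bms_scale bms_bracket scale_st (Phi_act lam \<alpha> \<beta> \<gamma> h) \<and>
         (irreducible_lie_module scale_st (Phi_act lam \<alpha> \<beta> \<gamma> h) \<longleftrightarrow> \<alpha> \<noteq> 0 \<or> \<beta> \<noteq> 0)"
  using lie_module_Phi[OF assms] irreducible_Phi[OF assms] not_irreducible_Phi by blast

end
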